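(* Let $\mathcal{D}=\{(\rho,\theta)\in\mathbb{R}^2:\rho>0,\theta>0\}$, let $\tau>0$ be a constant, and let $p,e,\lambda,\mu,\kappa\in C^\infty(\mathcal{D};\mathbb{R})$ satisfy, on all of $\mathcal{D}$, $\mu\ge 0$, $\tfrac23\mu+\lambda\ge 0$, $\kappa>0$, $p>0$, $p_\rho>0$, $p_\theta>0$, $e_\theta>0$. Put $\nu:=2\mu+\lambda$ and assume that either $\nu>0$ on all of $\mathcal{D}$ (viscous Cattaneo-Christov system) or $\nu\equiv 0$ on $\mathcal{D}$ (inviscid Cattaneo-Christov system). Let $\overline{U}=(\overline{\rho},\overline{u},\overline{\theta},0)^\top$ with $\overline{\rho}>0$, $\overline{\theta}>0$, $\overline{u}\in\mathbb{R}$ be any constant equilibrium state. Then the linearization of the one-dimensional Cattaneo-Christov system around $\overline{U}$, in the symmetric form $$A^0U_t+A^1U_x+LU=BU_{xx}$$ with the matrices $A^0,A^1,L,B$ (depending on $\overline{U}$) given in the context, is strictly dissipative: for every $\xi\in\mathbb{R}$, $\xi\ne 0$, every root $\lambda=\lambda(\xi)\in\mathbb{C}$ of $$\det\big(\lambda A^0+i\xi A^1+L+\xi^2B\big)=0$$ satisfies $\mathrm{Re}\,\lambda(\xi)<0$.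
   Context: The one-dimensional Cattaneo-Christov system for the mass density $\rho$, velocity $u$, absolute temperature $\theta$ and heat flux $q$ is $$\rho_t+(\rho u)_x=0,\quad (\rho u)_t+(\rho u^2+p)_x=(\nu u_x)_x,$$ $$\big(\rho(e+\tfrac12u^2)\big)_t+\big(\rho u(e+\tfrac12u^2)\big)_x=(-pu+\nu uu_x)_x-q_x,\quad \tau q_t+\tau uq_x+q=-\kappa\theta_x,$$ where $p=p(\rho,\theta)$ is the pressure, $e=e(\rho,\theta)$ the internal energy density, $\kappa$ the heat conductivity, $\lambda,\mu$ the viscosity coefficients, and subscripts $\rho,\theta$ on $p,e$ denote partial derivatives. Using the thermodynamic relation $\theta p_\theta=p-\rho^2e_\rho$, it is written in quasi-linear form for $U=(\rho,u,\theta,q)^\top$; equilibrium states are those with $q=0$. Linearizing around $\overline{U}$ and multiplying on the left by the symmetrizer $\mathrm{diag}\big(p_\rho/\rho,\,1,\,1/\theta,\,1/(\kappa\theta)\big)$ evaluated at $\overline{U}$ gives $A^0U_t+A^1U_x+LU=BU_{xx}$, with the following matrices, all functions being evaluated at $(\rho,u,\theta)=(\overline{\rho},\overline{u},\overline{\theta})$: $$A^0=\mathrm{diag}\Big(\frac{p_\rho}{\rho},\,\rho,\,\frac{\rho e_\theta}{\theta},\,\frac{\tau}{\kappa\theta}\Big),\qquad A^1=\begin{pmatrix}\frac{up_\rho}{\rho}&p_\rho&0&0\\ p_\rho&\rho u&p_\theta&0\\ 0&p_\theta&\frac{\rho ue_\theta}{\theta}&\frac1\theta\\ 0&0&\frac1\theta&\frac{\tau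 u}{\kappa\theta}\end{pmatrix},$$ $$B=\mathrm{diag}(0,\nu,0,0),\qquad L=\mathrm{diag}\Big(0,0,0,\frac{1}{\kappa\theta}\Big).$$ (The symbol $\lambda$ in the characteristic equation is a complex root, unrelated to the viscosity coefficient $\lambda$.) *)

theory Defs
  imports "HOL-Analysis.Analysis"
begin

section \<open>Smooth functions of two real variables\<close>

definition partial1 :: "(real \<times> real \<Rightarrow> real) \<Rightarrow> real \<times> real \<Rightarrow> real" where
  "partial1 f z = deriv (\<lambda>x. f (x, snd z)) (fst z)"

definition partial2 :: "(real \<times> real \<Rightarrow> real) \<Rightarrow> real \<times> real \<Rightarrow> real" where
  "partial2 f z = deriv (\<lambda>y. f (fst z, y)) (snd z)"

text \<open>Meant for open \<open>S\<close>: the partial derivatives at a point of \<open>S\<close> then depend only on the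
  values of the function on \<open>S\<close>, so that functions on \<open>S\<close> can be represented by total ones.
  Differentiability makes the values of \<^const>\<open>deriv\<close> meaningful.\<close>

fun C_k_on :: "nat \<Rightarrow> (real \<times> real \<Rightarrow> real) \<Rightarrow> (real \<times> real) set \<Rightarrow> bool" where
  "C_k_on 0 f S \<longleftrightarrow> continuous_on S f"
| "C_k_on (Suc k) f S \<longleftrightarrow>
     f differentiable_on S \<and> C_k_on k (partial1 f) S \<and> C_k_on k (partial2 f) S"

definition C_infinity_on :: "(real \<times> real \<Rightarrow> real) \<Rightarrow> (real \<times> real) set \<Rightarrow> bool" where
  "C_infinity_on f S \<longleftrightarrow> (\<forall>k. C_k_on k f S)"

section \<open>Strict dissipativity\<close>

definition symbol_matrix ::
    "real^'n^'n \<Rightarrow> real^'n^'n \<Rightarrow> real^'n^'n \<Rightarrow> real^'n^'n \<Rightarrow> real \<Rightarrow> complex \<Rightarrow> complex^'n^'n" where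
  "symbol_matrix A0 A1 L B \<xi> z =
     (\<chi> i j. z * complex_of_real (A0 $ i $ j) + \<i> * complex_of_real \<xi> * complex_of_real (A1 $ i $ j)
            + complex_of_real (L $ i $ j) + (complex_of_real \<xi>)\<^sup>2 * complex_of_real (B $ i $ j))"

text \<open>Strict dissipativity of \<open>A0 U\<^sub>t + A1 U\<^sub>x + L U = B U\<^sub>x\<^sub>x\<close>.\<close>

definition strictly_dissipative ::
    "real^'n^'n \<Rightarrow> real^'n^'n \<Rightarrow> real^'n^'n \<Rightarrow> real^'n^'n \<Rightarrow> bool" where
  "strictly_dissipative A0 A1 L B \<longleftrightarrow>
     (\<forall>\<xi>::real. \<xi> \<noteq> 0 \<longrightarrow>
        (\<forall>z::complex. det (symbol_matrix A0 A1 L B \<xi> z) = 0 \<longrightarrow> Re z < 0))"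

section \<open>The linearized Cattaneo-Christov system\<close>

text \<open>States are vectors \<open>U = (\<rho>, u, \<theta>, q)\<close>; constitutive functions depend on \<open>(\<rho>, \<theta>)\<close>.\<close>

definition thermo_domain :: "(real \<times> real) set" where
  "thermo_domain = {(\<rho>, \<theta>). \<rho> > 0 \<and> \<theta> > 0}"

definition equilibrium_state :: "real^4 \<Rightarrow> bool" where
  "equilibrium_state U \<longleftrightarrow> (U $ 1, U $ 3) \<in> thermo_domain \<and> U $ 4 = 0"

definition diag4 :: "real \<Rightarrow> real \<Rightarrow> real \<Rightarrow> real \<Rightarrow> real^4^4" where
  "diag4 a b c d = vector [vector [a, 0, 0, 0],
                           vector [0, b, 0, 0],
                           vector [0, 0, c, 0],
                           vector [0, 0, 0, d]]"

definition CC_A0 ::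
    "real \<Rightarrow> (real \<times> real \<Rightarrow> real) \<Rightarrow> (real \<times> real \<Rightarrow> real) \<Rightarrow> (real \<times> real \<Rightarrow> real) \<Rightarrow> real^4 \<Rightarrow> real^4^4" where
  "CC_A0 \<tau> p e \<kappa> U =
     (let \<rho> = U $ 1; \<theta> = U $ 3;
          p\<^sub>\<rho> = partial1 p (\<rho>, \<theta>); e\<^sub>\<theta> = partial2 e (\<rho>, \<theta>)
      in diag4 (p\<^sub>\<rho> / \<rho>) \<rho> (\<rho> * e\<^sub>\<theta> / \<theta>) (\<tau> / (\<kappa> (\<rho>, \<theta>) * \<theta>)))"

definition CC_A1 ::
    "real \<Rightarrow> (real \<times> real \<Rightarrow> real) \<Rightarrow> (real \<times> real \<Rightarrow> real) \<Rightarrow> (real \<times> real \<Rightarrow> real) \<Rightarrow> real^4 \<Rightarrow> real^4^4" where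
  "CC_A1 \<tau> p e \<kappa> U =
     (let \<rho> = U $ 1; u = U $ 2; \<theta> = U $ 3;
          p\<^sub>\<rho> = partial1 p (\<rho>, \<theta>); p\<^sub>\<theta> = partial2 p (\<rho>, \<theta>); e\<^sub>\<theta> = partial2 e (\<rho>, \<theta>)
      in vector [vector [u * p\<^sub>\<rho> / \<rho>, p\<^sub>\<rho>,   0,                0],
                 vector [p\<^sub>\<rho>,         \<rho> * u, p\<^sub>\<theta>,               0],
                 vector [0,          p\<^sub>\<theta>,   \<rho> * u * e\<^sub>\<theta> / \<theta>, 1 / \<theta>],
                 vector [0,          0,    1 / \<theta>,            \<tau> * u / (\<kappa> (\<rho>, \<theta>) * \<theta>)]])"

definition CC_L :: "(real \<times> real \<Rightarrow> real) \<Rightarrow> real^4 \<Rightarrow> real^4^4" where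
  "CC_L \<kappa> U = (let \<rho> = U $ 1; \<theta> = U $ 3 in diag4 0 0 0 (1 / (\<kappa> (\<rho>, \<theta>) * \<theta>)))"

definition CC_B :: "(real \<times> real \<Rightarrow> real) \<Rightarrow> real^4 \<Rightarrow> real^4^4" where
  "CC_B \<nu> U = diag4 0 (\<nu> (U $ 1, U $ 3)) 0 0"

lemma vector_4 [simp]:
  "(vector [a, b, c, d] :: ('a::zero)^4) $ 1 = a"
  "(vector [a, b, c, d] :: ('a::zero)^4) $ 2 = b"
  "(vector [a, b, c, d] :: ('a::zero)^4) $ 3 = c"
  "(vector [a, b, c, d] :: ('a::zero)^4) $ 4 = d"
  unfolding vector_def by simp_all

end

theory Submission
  imports Defs
begin

text \<open>The symmetric matrices of the system make an energy argument work. If the symbol matrix is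
  singular, pair a kernel vector \<open>v = x + iy\<close> with itself: the convective term drops out and
  \<open>Re z\<close> times a positive quantity equals minus the dissipation of \<open>L\<close> and \<open>B\<close>, so \<open>Re z \<le> 0\<close>. If
  \<open>Re z = 0\<close>, then \<open>x\<close> and \<open>y\<close> lie in the kernels of \<open>L\<close> and \<open>B\<close> and satisfy \<open>A1 x = c A0 x\<close>. The
  coupling condition of Shizuta and Kawashima excludes nonzero such vectors; here it holds because
  \<open>L\<close> already kills the heat flux, whose equation then kills the temperature, whose equation kills
  the velocity, whose equation kills the density.\<close>

lemma symmetric_matrix_inner:
  fixes A :: "real^'n^'n"
  assumes "transpose A = A"
  shows "x \<bullet> (A *v y) = y \<bullet> (A *v x)"
  by (metis assms dot_lmul_matrix inner_commute transpose_matrix_vector)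

text \<open>A zero of a nonnegative quadratic form is a minimum, and by symmetry the gradient there
  is \<open>2 *\<^sub>R (A *v x)\<close>. If it did not vanish, a short step against it would make
  the form negative.\<close>

lemma psd_matrix_kernel:
  fixes A :: "real^'n^'n"
  assumes sym: "transpose A = A"
    and psd: "\<And>x. x \<bullet> (A *v x) \<ge> 0"
    and zero: "x \<bullet> (A *v x) = 0"
  shows "A *v x = 0"
proof (rule ccontr)
  assume "A *v x \<noteq> 0"
  define w where "w = A *v x"
  define c where "c = w \<bullet> (A *v w)"
  \<comment> \<open>Along \<open>x + t *\<^sub>R w\<close> the form equals
    \<open>t * (2 * (w \<bullet> w) + t * c)\<close>. This \<open>t\<close> is negative but small
    enough to keep the bracket positive; the \<open>+ 1\<close> avoids division by zero when
    \<open>c = 0\<close>.\<close>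
  define t where "t = - (w \<bullet> w) / (c + 1)"
  have c: "c \<ge> 0" and w: "w \<bullet> w > 0"
    using psd \<open>A *v x \<noteq> 0\<close> by (auto simp: c_def w_def)
  have "x \<bullet> (A *v w) = w \<bullet> w"
    using symmetric_matrix_inner[OF sym, of x w] by (simp add: w_def)
  then have "(x + t *\<^sub>R w) \<bullet> (A *v (x + t *\<^sub>R w)) = t * (2 * (w \<bullet> w) + t * c)"
    using zero by (simp add: matrix_vector_right_distrib matrix_vector_mult_scaleR inner_add
        c_def w_def[symmetric] algebra_simps)
  moreover have "t < 0"
    using c w by (simp add: t_def divide_neg_pos)
  moreover have "t * c \<ge> - (w \<bullet> w)"
    using c w by (simp add: t_def field_simps)
  ultimately have "(x + t *\<^sub>R w) \<bullet> (A *v (x + t *\<^sub>R w)) < 0"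
    using mult_neg_pos[of t "2 * (w \<bullet> w) + t * c"] w by linarith
  then show False
    using psd[of "x + t *\<^sub>R w"] by linarith
qed

text \<open>Splitting a complex kernel vector into real and imaginary parts lets the energy argument
  run entirely over real symmetric matrices.\<close>

lemma singular_symbol_matrix_kernel:
  assumes "det (symbol_matrix A0 A1 L B \<xi> z) = 0"
  obtains x y :: "real^'n" where "x \<noteq> 0 \<or> y \<noteq> 0"
    and "Re z *\<^sub>R (A0 *v x) - Im z *\<^sub>R (A0 *v y) - \<xi> *\<^sub>R (A1 *v y) + L *v x + \<xi>\<^sup>2 *\<^sub>R (B *v x) = 0"
    and "Re z *\<^sub>R (A0 *v y) + Im z *\<^sub>R (A0 *v x) + \<xi> *\<^sub>R (A1 *v x) + L *v y + \<xi>\<^sup>2 *\<^sub>R (B *v y) = 0"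
proof -
  let ?M = "symbol_matrix A0 A1 L B \<xi> z"
  obtain v where v: "?M *v v = 0" "v \<noteq> 0"
    using assms by (metis invertible_det_nz invertible_left_inverse matrix_left_invertible_ker)
  define x y where "x = (\<chi> i. Re (v $ i))" and "y = (\<chi> i. Im (v $ i))"
  have row: "(\<Sum>j\<in>UNIV. ?M $ i $ j * v $ j) = 0" for i
    using v(1) by (simp add: matrix_vector_mult_def vec_eq_iff)
  have "x \<noteq> 0 \<or> y \<noteq> 0"
    using v(2) by (auto simp: x_def y_def vec_eq_iff complex_eq_iff)
  moreover have
    "Re z *\<^sub>R (A0 *v x) - Im z *\<^sub>R (A0 *v y) - \<xi> *\<^sub>R (A1 *v y) + L *v x + \<xi>\<^sup>2 *\<^sub>R (B *v x) = 0"
    using arg_cong[OF row, of Re]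
    by (simp add: vec_eq_iff matrix_vector_mult_def symbol_matrix_def x_def y_def
        sum_distrib_left flip: sum.distrib sum_subtractf of_real_power)
      (simp add: algebra_simps)
  moreover have
    "Re z *\<^sub>R (A0 *v y) + Im z *\<^sub>R (A0 *v x) + \<xi> *\<^sub>R (A1 *v x) + L *v y + \<xi>\<^sup>2 *\<^sub>R (B *v y) = 0"
    using arg_cong[OF row, of Im]
    by (simp add: vec_eq_iff matrix_vector_mult_def symbol_matrix_def x_def y_def
        sum_distrib_left flip: sum.distrib sum_subtractf of_real_power)
      (simp add: algebra_simps)
  ultimately show ?thesis
    by (rule that)
qed

text \<open>An abstract criterion, in any dimension: a mode with \<open>Re z = 0\<close> would
  escape all dissipation and travel along an eigenvector of \<open>A1\<close> relative to
  \<open>A0\<close>, which \<open>coupling\<close> forbids.\<close>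

lemma strictly_dissipative_if_coupling:
  fixes A0 A1 L B :: "real^'n^'n"
  assumes sym: "transpose A0 = A0" "transpose A1 = A1" "transpose L = L" "transpose B = B"
    and pos: "\<And>x. x \<noteq> 0 \<Longrightarrow> x \<bullet> (A0 *v x) > 0"
    and L: "\<And>x. x \<bullet> (L *v x) \<ge> 0"
    and B: "\<And>x. x \<bullet> (B *v x) \<ge> 0"
    and coupling: "\<And>x c. \<lbrakk>L *v x = 0; B *v x = 0; A1 *v x = c *\<^sub>R (A0 *v x)\<rbrakk> \<Longrightarrow> x = 0"
  shows "strictly_dissipative A0 A1 L B"
  unfolding strictly_dissipative_def
proof (intro allI impI)
  fix \<xi> :: real and z :: complex
  assume \<xi>: "\<xi> \<noteq> 0" and "det (symbol_matrix A0 A1 L B \<xi> z) = 0"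
  then obtain x y where nz: "x \<noteq> 0 \<or> y \<noteq> 0"
    and re: "Re z *\<^sub>R (A0 *v x) - Im z *\<^sub>R (A0 *v y) - \<xi> *\<^sub>R (A1 *v y) + L *v x + \<xi>\<^sup>2 *\<^sub>R (B *v x) = 0"
    and im: "Re z *\<^sub>R (A0 *v y) + Im z *\<^sub>R (A0 *v x) + \<xi> *\<^sub>R (A1 *v x) + L *v y + \<xi>\<^sup>2 *\<^sub>R (B *v y) = 0"
    by (metis singular_symbol_matrix_kernel)
  define a where "a = x \<bullet> (A0 *v x) + y \<bullet> (A0 *v y)"
  define l where "l = x \<bullet> (L *v x) + y \<bullet> (L *v y)"
  define b where "b = x \<bullet> (B *v x) + y \<bullet> (B *v y)"
  have "x \<bullet> (A0 *v x) \<ge> 0" "y \<bullet> (A0 *v y) \<ge> 0"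
    using pos[of x] pos[of y] by (cases "x = 0"; cases "y = 0"; simp)+
  then have a: "a > 0"
    using nz pos[of x] pos[of y] unfolding a_def by fastforce
  have l: "l \<ge> 0" and b: "\<xi>\<^sup>2 * b \<ge> 0"
    using L B by (simp_all add: l_def b_def)
  \<comment> \<open>Pair \<open>re\<close> with \<open>x\<close> and \<open>im\<close> with
    \<open>y\<close> and add: by symmetry of \<open>A0\<close> and \<open>A1\<close> the terms with
    \<open>Im z\<close> and with \<open>\<xi>\<close> cancel.\<close>
  have energy: "Re z * a + l + \<xi>\<^sup>2 * b = 0"
    using arg_cong[OF re, of "(\<bullet>) x"] arg_cong[OF im, of "(\<bullet>) y"]
      symmetric_matrix_inner[OF sym(1), of x y] symmetric_matrix_inner[OF sym(2), of x y]
    by (simp add: inner_add_right inner_diff_right a_def l_def b_def algebra_simps)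
  show "Re z < 0"
  proof (rule ccontr)
    assume "\<not> Re z < 0"
    then have "Re z * a \<ge> 0"
      using a by simp
    then have "Re z * a = 0" "l = 0" "\<xi>\<^sup>2 * b = 0"
      using energy l b by linarith+
    then have zero: "Re z = 0" "l = 0" "b = 0"
      using a \<xi> by auto
    \<comment> \<open>Both summands of \<open>l\<close> are nonnegative, so each vanishes
      separately; semidefiniteness turns this into membership in the kernel. The same applies to
      \<open>b\<close>.\<close>
    have kerL: "L *v x = 0" "L *v y = 0"
      using zero(2) L[of x] L[of y] by (auto simp: l_def intro!: psd_matrix_kernel[OF sym(3) L])
    have kerB: "B *v x = 0" "B *v y = 0"
      using zero(3) B[of x] B[of y] by (auto simp: b_def intro!: psd_matrix_kernel[OF sym(4) B])
    \<comment> \<open>With \<open>Re z = 0\<close> and the dissipation gone, the system decouples: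
      \<open>im\<close> involves only \<open>x\<close> and \<open>re\<close> only \<open>y\<close>,
      with the same real factor \<open>- Im z / \<xi>\<close>.\<close>
    have "\<xi> *\<^sub>R (A1 *v x) = \<xi> *\<^sub>R ((- Im z / \<xi>) *\<^sub>R (A0 *v x))"
      using im kerL kerB zero(1) \<xi> by (simp add: eq_neg_iff_add_eq_0 add.commute)
    moreover have "\<xi> *\<^sub>R (A1 *v y) = \<xi> *\<^sub>R ((- Im z / \<xi>) *\<^sub>R (A0 *v y))"
      using re kerL kerB zero(1) \<xi> by (simp add: algebra_simps)
    ultimately have "x = 0" "y = 0"
      using coupling kerL kerB \<xi> by (metis scaleR_cancel_left)+
    then show False
      using nz by simp
  qed
qed

lemma diag4_mult_vector:
  "diag4 a b c d *v x = vector [a * x $ 1, b * x $ 2, c * x $ 3, d * x $ 4]"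
  by (simp add: vec_eq_iff forall_4 matrix_vector_mult_def diag4_def sum_4)

lemma transpose_diag4: "transpose (diag4 a b c d) = diag4 a b c d"
  by (simp add: vec_eq_iff forall_4 transpose_def diag4_def)

lemma inner_diag4:
  "x \<bullet> (diag4 a b c d *v x) = a * (x $ 1)\<^sup>2 + b * (x $ 2)\<^sup>2 + c * (x $ 3)\<^sup>2 + d * (x $ 4)\<^sup>2"
  by (simp add: diag4_mult_vector inner_vec_def sum_4 power2_eq_square)

lemma inner_diag4_nonneg:
  assumes "a \<ge> 0" "b \<ge> 0" "c \<ge> 0" "d \<ge> 0"
  shows "x \<bullet> (diag4 a b c d *v x) \<ge> 0"
  using assms by (simp add: inner_diag4)

lemma inner_diag4_pos:
  assumes "a > 0" "b > 0" "c > 0" "d > 0" "x \<noteq> 0"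
  shows "x \<bullet> (diag4 a b c d *v x) > 0"
proof -
  have "x $ 1 \<noteq> 0 \<or> x $ 2 \<noteq> 0 \<or> x $ 3 \<noteq> 0 \<or> x $ 4 \<noteq> 0"
    using \<open>x \<noteq> 0\<close> by (simp add: vec_eq_iff forall_4)
  then have "a * (x $ 1)\<^sup>2 > 0 \<or> b * (x $ 2)\<^sup>2 > 0 \<or> c * (x $ 3)\<^sup>2 > 0 \<or> d * (x $ 4)\<^sup>2 > 0"
    using assms(1-4) by (simp add: zero_less_mult_iff)
  moreover have "a * (x $ 1)\<^sup>2 \<ge> 0" "b * (x $ 2)\<^sup>2 \<ge> 0" "c * (x $ 3)\<^sup>2 \<ge> 0" "d * (x $ 4)\<^sup>2 \<ge> 0"
    using assms(1-4) by simp_all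
  ultimately show ?thesis
    unfolding inner_diag4 by linarith
qed

theorem mainTheorem1:
  fixes \<tau> :: real
    and p e lam \<mu> \<kappa> \<nu> :: "real \<times> real \<Rightarrow> real"
    and U :: "real^4"
  assumes "\<tau> > 0"
    and "C_infinity_on p thermo_domain"
    and "C_infinity_on e thermo_domain"
    and "C_infinity_on lam thermo_domain"
    and "C_infinity_on \<mu> thermo_domain"
    and "C_infinity_on \<kappa> thermo_domain"
    and "\<forall>z\<in>thermo_domain. \<mu> z \<ge> 0"
    and "\<forall>z\<in>thermo_domain. (2/3) * \<mu> z + lam z \<ge> 0"
    and "\<forall>z\<in>thermo_domain. \<kappa> z > 0"
    and "\<forall>z\<in>thermo_domain. p z > 0"
    and "\<forall>z\<in>thermo_domain. partial1 p z > 0"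
    and "\<forall>z\<in>thermo_domain. partial2 p z > 0"
    and "\<forall>z\<in>thermo_domain. partial2 e z > 0"
    and "\<forall>z\<in>thermo_domain. \<nu> z = 2 * \<mu> z + lam z"
    and "(\<forall>z\<in>thermo_domain. \<nu> z > 0) \<or> (\<forall>z\<in>thermo_domain. \<nu> z = 0)"
    and "equilibrium_state U"
  shows "strictly_dissipative (CC_A0 \<tau> p e \<kappa> U) (CC_A1 \<tau> p e \<kappa> U) (CC_L \<kappa> U) (CC_B \<nu> U)"
proof -
  define \<rho> u \<theta> where "\<rho> = U $ 1" and "u = U $ 2" and "\<theta> = U $ 3"
  note U = \<rho>_def[symmetric] u_def[symmetric] \<theta>_def[symmetric]
  have dom: "(\<rho>, \<theta>) \<in> thermo_domain"
    using \<open>equilibrium_state U\<close> by (simp add: equilibrium_state_def U)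
  then have \<rho>: "\<rho> > 0" and \<theta>: "\<theta> > 0"
    by (auto simp: thermo_domain_def)
  have \<kappa>: "\<kappa> (\<rho>, \<theta>) > 0" and p1: "partial1 p (\<rho>, \<theta>) > 0" and p2: "partial2 p (\<rho>, \<theta>) > 0"
    and e2: "partial2 e (\<rho>, \<theta>) > 0" and \<nu>: "\<nu> (\<rho>, \<theta>) \<ge> 0"
    \<comment> \<open>The viscous and the inviscid alternative both give
      \<open>\<nu> (\<rho>, \<theta>) \<ge> 0\<close>, which is how the two cases are treated at
      once.\<close>
    using dom assms by (auto simp: less_imp_le)
  note pos = \<open>\<tau> > 0\<close> \<rho> \<theta> \<kappa> p1 p2 e2
  note mats = CC_A0_def CC_L_def CC_B_def Let_def U
  show ?thesis
  proof (rule strictly_dissipative_if_coupling)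
    show "transpose (CC_A1 \<tau> p e \<kappa> U) = CC_A1 \<tau> p e \<kappa> U"
      by (simp add: vec_eq_iff forall_4 transpose_def CC_A1_def Let_def)
  next
    fix x :: "real^4" assume "x \<noteq> 0"
    then show "x \<bullet> (CC_A0 \<tau> p e \<kappa> U *v x) > 0"
      using pos by (simp add: mats inner_diag4_pos)
  next
    fix x :: "real^4" and c
    assume L: "CC_L \<kappa> U *v x = 0"
      and A: "CC_A1 \<tau> p e \<kappa> U *v x = c *\<^sub>R (CC_A0 \<tau> p e \<kappa> U *v x)"
    have 4: "x $ 4 = 0"
      using L \<theta> \<kappa> by (simp add: mats diag4_mult_vector vec_eq_iff forall_4)
    \<comment> \<open>Since \<open>CC_A0\<close> is diagonal, row \<open>i\<close> has a right-hand
      side proportional to \<open>x $ i\<close>. Once that component and the later ones vanish, only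
      the preceding component survives, with nonzero coefficient \<open>1 / \<theta>\<close>,
      \<open>p\<^sub>\<theta>\<close> or \<open>p\<^sub>\<rho>\<close> in rows 4, 3 and 2.\<close>
    have row: "(CC_A1 \<tau> p e \<kappa> U *v x) $ i = (c *\<^sub>R (CC_A0 \<tau> p e \<kappa> U *v x)) $ i" for i
      using A by simp
    note defs = mats CC_A1_def diag4_mult_vector
    have 3: "x $ 3 = 0"
      using row[of 4] 4 \<theta> by (simp add: defs matrix_vector_mult_def[of "vector _"] sum_4)
    have 2: "x $ 2 = 0"
      using row[of 3] 3 4 p2 by (simp add: defs matrix_vector_mult_def[of "vector _"] sum_4)
    have "x $ 1 = 0"
      using row[of 2] 2 3 4 p1 by (simp add: defs matrix_vector_mult_def[of "vector _"] sum_4)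
    with 2 3 4 show "x = 0"
      by (simp add: vec_eq_iff forall_4)
  qed (use pos \<nu> in \<open>simp_all add: mats transpose_diag4 inner_diag4_nonneg\<close>)
qed

end
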